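(* Let $X$ and $Y$ be paracompact Hausdorff spaces and let $f\colon X\to Y$ be a continuous map all of whose fibers $f^{-1}(y)$, $y\in Y$, are compact, and such that $W(f)\leq\aleph_0$. Then for every compact metrizable free space $M$, the space $C(X,M)$ equipped with the uniform convergence topology contains a dense subset of maps $g$ such that for every $y\in Y$ the restriction $g|f^{-1}(y)\colon f^{-1}(y)\to M$ is a Bing map.
   Context: All maps are continuous, and $C(X,M)$ denotes the set of all continuous maps from $X$ to $M$. For a compact metrizable space $M$, the uniform convergence topology on $C(X,M)$ is the topology generated by the metric $\sup_{x\in X} d(g(x),h(x))$, where $d$ is any metric on $M$ compatible with its topology. The spaces $X$ and $Y$ are paracompact Hausdorff and need not be metrizable. $W(f)\leq\aleph_0$ means that there exists a continuous map $g\colon X\to\mathbb{I}^{\aleph_0}$ into the Hilbert cube $\mathbb{I}^{\aleph_0}=[0,1]^{\aleph_0}$ such that the diagonal map $f\triangle g\colon X\to Y\times\mathbb{I}^{\aleph_0}$, $x\mapsto (f(x),g(x))$, is a topological embedding. A compactum means a compact metrizable space. A continuum is a connected compactum; it is indecomposable if it is not the union of two proper subcontinua. A compactum is a Bing space if each of its subcontinua is indecomposable. A map between compact spaces is a Bing map if all its fibers are Bing spaces. A metrizable space $M$ is a free space if for every compactum $K$ the function space $C(K,M)$, with the uniform convergence topology, contains a dense subset consisting of maps all of whose fibers are Bing spaces (Bing maps). *)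

theory Defs
  imports "HOL-Analysis.Analysis"
begin

text \<open>
  Spaces are abstract topologies \<open>X :: 'a topology\<close> with carrier \<^term>\<open>topspace X\<close>, so that
  fibers, subcontinua and function spaces are all treated uniformly (and may be empty).
\<close>

definition paracompact_space :: "'a topology \<Rightarrow> bool" where
  "paracompact_space X \<longleftrightarrow>
     (\<forall>\<U>. (\<forall>U\<in>\<U>. openin X U) \<and> \<Union>\<U> = topspace X \<longrightarrow>
        (\<exists>\<V>. (\<forall>V\<in>\<V>. openin X V) \<and> \<Union>\<V> = topspace X \<and>
             (\<forall>V\<in>\<V>. \<exists>U\<in>\<U>. V \<subseteq> U) \<and> locally_finite_in X \<V>))"

definition fiber :: "'a topology \<Rightarrow> ('a \<Rightarrow> 'b) \<Rightarrow> 'b \<Rightarrow> 'a topology" where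
  "fiber X f y = subtopology X {x \<in> topspace X. f x = y}"

definition hilbert_cube :: "(nat \<Rightarrow> real) topology" where
  "hilbert_cube = product_topology (\<lambda>_. top_of_set {0..1}) UNIV"

text \<open>The condition $W(f) \leq \aleph_0$.\<close>

definition W_le_aleph0 :: "'a topology \<Rightarrow> 'b topology \<Rightarrow> ('a \<Rightarrow> 'b) \<Rightarrow> bool" where
  "W_le_aleph0 X Y f \<longleftrightarrow>
     (\<exists>g. continuous_map X hilbert_cube g \<and>
          embedding_map X (prod_topology Y hilbert_cube) (\<lambda>x. (f x, g x)))"


subsection \<open>Continua and Bing spaces\<close>

definition compactum :: "'a topology \<Rightarrow> bool" where
  "compactum X \<longleftrightarrow> compact_space X \<and> metrizable_space X"

text \<open>
  The empty space is admitted as a (trivially indecomposable) continuum. This does not affect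
  which spaces are Bing spaces: an empty piece never helps to decompose a continuum into
  proper subcontinua.
\<close>

definition continuum :: "'a topology \<Rightarrow> bool" where
  "continuum X \<longleftrightarrow> compactum X \<and> connected_space X"

definition subcontinuum :: "'a topology \<Rightarrow> 'a set \<Rightarrow> bool" where
  "subcontinuum X C \<longleftrightarrow> C \<subseteq> topspace X \<and> continuum (subtopology X C)"

definition indecomposable_continuum :: "'a topology \<Rightarrow> bool" where
  "indecomposable_continuum X \<longleftrightarrow>
     continuum X \<and>
     (\<nexists>A B. subcontinuum X A \<and> A \<noteq> topspace X \<and>
            subcontinuum X B \<and> B \<noteq> topspace X \<and> topspace X = A \<union> B)"

definition Bing_space :: "'a topology \<Rightarrow> bool" where
  "Bing_space X \<longleftrightarrow>
     compactum X \<and>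
     (\<forall>C. subcontinuum X C \<longrightarrow> indecomposable_continuum (subtopology X C))"

definition Bing_map :: "'a topology \<Rightarrow> 'b topology \<Rightarrow> ('a \<Rightarrow> 'b) \<Rightarrow> bool" where
  "Bing_map X Y f \<longleftrightarrow>
     compact_space X \<and> compact_space Y \<and> continuous_map X Y f \<and>
     (\<forall>y\<in>topspace Y. Bing_space (fiber X f y))"


subsection \<open>The uniform convergence topology\<close>

text \<open>
  \<^const>\<open>cfunspace\<close> is the space of bounded continuous maps with the sup metric; a map is
  represented by its extensional version (\<^const>\<open>undefined\<close> off \<^term>\<open>topspace X\<close>).
  The notion is only used when \<open>M\<close> is metrizable and \<open>X\<close> or \<open>M\<close> is compact.  Then
  boundedness is automatic, and the topology does not depend on the chosen metric: see
  \<open>topspace_uniform_convergence_topology\<close> and \<open>uniform_convergence_topology_eq\<close> below.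
\<close>

definition uniform_convergence_topology ::
    "'a topology \<Rightarrow> 'b topology \<Rightarrow> ('a \<Rightarrow> 'b) topology" where
  "uniform_convergence_topology X M =
     mtopology_of (cfunspace X (SOME d. mtopology_of d = M))"

lemma metrizable_space_iff_mtopology_of:
  "metrizable_space M \<longleftrightarrow> (\<exists>d. mtopology_of d = M)"
proof
  assume "metrizable_space M"
  then obtain S \<rho> where S: "Metric_space S \<rho>" "M = Metric_space.mtopology S \<rho>"
    unfolding metrizable_space_def by blast
  then show "\<exists>d. mtopology_of d = M"
    using Metric_space.mtopology_of[OF S(1)] by auto
next
  assume "\<exists>d. mtopology_of d = M"
  then obtain d where "mtopology_of d = M" ..
  then show "metrizable_space M"
    using Metric_space.metrizable_space_mtopology[of "mspace d" "mdist d"]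
    by (simp add: mtopology_of_def)
qed

lemma mspace_cfunspace_compact:
  assumes d: "mtopology_of d = M" and c: "compact_space X \<or> compact_space M"
  shows "mspace (cfunspace X d) = {f \<in> extensional (topspace X). continuous_map X M f}"
proof -
  interpret Metric_space "mspace d" "mdist d" by simp
  have M: "mtopology = M" using d by (simp add: mtopology_of_def)
  have "mbounded (f ` topspace X)" if f: "continuous_map X M f" for f
    using c
  proof
    assume "compact_space X"
    then show ?thesis
      using M f compactin_imp_mbounded compact_space_def image_compactin by metis
  next
    assume "compact_space M"
    then have "mbounded (topspace M)"
      using M compactin_imp_mbounded compact_space_def by metis
    moreover have "f ` topspace X \<subseteq> topspace M"
      using f continuous_map_image_subset_topspace by blast
    ultimately show ?thesis using mbounded_subset by blast
  qed
  moreover have "f \<in> topspace X \<rightarrow> mspace d" if "continuous_map X M f" for f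
    using that M by (metis continuous_map_funspace topspace_mtopology)
  ultimately show ?thesis
    using d by auto
qed

lemma topspace_uniform_convergence_topology:
  assumes "metrizable_space M" "compact_space X \<or> compact_space M"
  shows "topspace (uniform_convergence_topology X M)
           = {f \<in> extensional (topspace X). continuous_map X M f}"
proof -
  have "mtopology_of (SOME d. mtopology_of d = M) = M"
    using assms(1) unfolding metrizable_space_iff_mtopology_of by (rule someI_ex)
  from mspace_cfunspace_compact[OF this assms(2)] show ?thesis
    unfolding uniform_convergence_topology_def topspace_mtopology_of .
qed

lemma compatible_metrics_uniform_at_compact:
  assumes eq: "mtopology_of d1 = mtopology_of d2"
    and S: "compactin (mtopology_of d1) S" and e: "e > 0"
  shows "\<exists>\<delta>>0. \<forall>p\<in>S. \<forall>q\<in>mspace d1. mdist d1 p q < \<delta> \<longrightarrow> mdist d2 p q < e"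
proof -
  interpret A: Metric_space "mspace d1" "mdist d1" by simp
  interpret B: Metric_space "mspace d2" "mdist d2" by simp
  have eq': "A.mtopology = B.mtopology" using eq by (simp add: mtopology_of_def)
  have sp: "mspace d1 = mspace d2"
    using eq by (metis topspace_mtopology_of)
  have Ssub: "S \<subseteq> mspace d1" using S by (metis compactin_subset_topspace topspace_mtopology_of)
  have "\<exists>r>0. A.mball p (2 * r) \<subseteq> B.mball p (e/2)" if "p \<in> S" for p
  proof -
    have "openin A.mtopology (B.mball p (e/2))" by (simp add: eq')
    moreover have "p \<in> B.mball p (e/2)" using that Ssub sp e by auto
    ultimately obtain r where "r > 0" "A.mball p r \<subseteq> B.mball p (e/2)"
      unfolding A.openin_mtopology by blast
    then show ?thesis by (intro exI[of _ "r/2"]) auto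
  qed
  then obtain r where r: "\<And>p. p \<in> S \<Longrightarrow> r p > 0"
      "\<And>p. p \<in> S \<Longrightarrow> A.mball p (2 * r p) \<subseteq> B.mball p (e/2)"
    by metis
  have "S \<subseteq> \<Union>((\<lambda>p. A.mball p (r p)) ` S)" using r(1) Ssub by fastforce
  then obtain \<F> where "finite \<F>" "\<F> \<subseteq> (\<lambda>p. A.mball p (r p)) ` S" "S \<subseteq> \<Union>\<F>"
    using S unfolding compactin_def mtopology_of_def
    by (metis (mono_tags, lifting) A.openin_mball imageE)
  then obtain T where T: "finite T" "T \<subseteq> S" "S \<subseteq> (\<Union>p\<in>T. A.mball p (r p))"
    using finite_subset_image[of \<F> "\<lambda>p. A.mball p (r p)" S] by blast
  define \<delta> where "\<delta> = Min (insert 1 (r ` T))"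
  have "\<delta> > 0" using T r(1) by (auto simp: \<delta>_def)
  moreover have "mdist d2 p q < e" if pq: "p \<in> S" "q \<in> mspace d1" "mdist d1 p q < \<delta>" for p q
  proof -
    obtain z where z: "z \<in> T" "p \<in> A.mball z (r z)" using T pq by blast
    have "\<delta> \<le> r z" using z T by (auto simp: \<delta>_def)
    moreover have zz: "z \<in> mspace d1" "p \<in> mspace d1" "mdist d1 z p < r z" using z(2) by simp_all
    moreover have "mdist d1 z q \<le> mdist d1 z p + mdist d1 p q"
      using A.triangle zz pq by blast
    moreover have "0 \<le> mdist d1 z p" by simp
    ultimately have "mdist d1 z q < 2 * r z" "mdist d1 z p < 2 * r z"
      using pq(3) by linarith+
    then have "q \<in> A.mball z (2 * r z)" "p \<in> A.mball z (2 * r z)"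
      using zz pq(2) unfolding A.in_mball by blast+
    then have "q \<in> B.mball z (e/2)" "p \<in> B.mball z (e/2)"
      using r(2) z(1) T(2) by blast+
    then have "mdist d2 z q < e/2" "mdist d2 z p < e/2" by auto
    moreover have "mdist d2 p q \<le> mdist d2 p z + mdist d2 z q"
      using B.triangle zz pq sp by blast
    ultimately show ?thesis by (simp add: mdist_commute)
  qed
  ultimately show ?thesis by blast
qed

lemma uniform_convergence_topology_mono:
  assumes d1: "mtopology_of d1 = M" and d2: "mtopology_of d2 = M"
    and c: "compact_space X \<or> compact_space M"
    and U: "openin (mtopology_of (cfunspace X d1)) U"
  shows "openin (mtopology_of (cfunspace X d2)) U"
proof -
  let ?F1 = "cfunspace X d1" and ?F2 = "cfunspace X d2"
  interpret A: Metric_space "mspace ?F1" "mdist ?F1" by (rule Metric_space_mspace_mdist)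
  interpret B: Metric_space "mspace ?F2" "mdist ?F2" by (rule Metric_space_mspace_mdist)
  have sp: "mspace ?F1 = mspace ?F2"
    unfolding mspace_cfunspace_compact[OF d1 c] mspace_cfunspace_compact[OF d2 c] ..
  have U': "U \<subseteq> mspace ?F1" "\<And>f. f \<in> U \<Longrightarrow> \<exists>r>0. A.mball f r \<subseteq> U"
    using U unfolding mtopology_of_def A.openin_mtopology by blast+
  have "\<exists>r>0. B.mball f r \<subseteq> U" if f: "f \<in> U" for f
  proof -
    obtain r where r: "r > 0" "A.mball f r \<subseteq> U" using U' f by blast
    have f1: "f \<in> mspace ?F1" using U' f by blast
    then have fc: "continuous_map X M f" using d1 by simp
    obtain S where S: "compactin M S" "f ` topspace X \<subseteq> S"
    proof -
      have "compactin M (f ` topspace X)" if "compact_space X"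
        using that fc unfolding compact_space_def by (rule image_compactin)
      moreover have "f ` topspace X \<subseteq> topspace M"
        using fc by (rule continuous_map_image_subset_topspace)
      ultimately show ?thesis
        using c that unfolding compact_space_def by blast
    qed
    obtain \<delta> where \<delta>: "\<delta> > 0"
        "\<And>p q. p \<in> S \<Longrightarrow> q \<in> mspace d2 \<Longrightarrow> mdist d2 p q < \<delta> \<Longrightarrow> mdist d1 p q < r/2"
    proof -
      have "mtopology_of d2 = mtopology_of d1" "compactin (mtopology_of d2) S" "r/2 > 0"
        using S(1) d1 d2 r(1) by simp_all
      from compatible_metrics_uniform_at_compact[OF this] show ?thesis
        using that by blast
    qed
    have "g \<in> A.mball f r" if g: "g \<in> B.mball f \<delta>" for g
    proof -
      have g2: "f \<in> mspace ?F2" "g \<in> mspace ?F2" "mdist ?F2 f g < \<delta>"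
        using g by (simp_all only: B.in_mball)
      have "mdist d1 (f x) (g x) \<le> r/2" if x: "x \<in> topspace X" for x
      proof -
        have "mdist d2 (f x) (g x) < \<delta>"
          using mdist_cfunspace_imp_mdist_le[OF g2(1,2) order_refl x] g2(3) by (rule le_less_trans)
        moreover have "g x \<in> mspace d2" using g2(2) x by auto
        moreover have "f x \<in> S" using S(2) x by blast
        ultimately have "mdist d1 (f x) (g x) < r/2" by (intro \<delta>(2))
        then show ?thesis by simp
      qed
      then have "mdist ?F1 f g \<le> r/2" using r(1) by (intro mdist_cfunspace_le) auto
      then have "mdist ?F1 f g < r" using r(1) by linarith
      then show ?thesis using f1 g2 sp unfolding A.in_mball by blast
    qed
    then show ?thesis using r(2) \<delta>(1) by blast
  qed
  then show ?thesis
    using U'(1) sp unfolding mtopology_of_def B.openin_mtopology by blast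
qed

lemma uniform_convergence_topology_eq:
  assumes d: "mtopology_of d = M" and c: "compact_space X \<or> compact_space M"
  shows "uniform_convergence_topology X M = mtopology_of (cfunspace X d)"
proof -
  have s: "mtopology_of (SOME d. mtopology_of d = M) = M"
    using d by (rule someI)
  show ?thesis
    unfolding uniform_convergence_topology_def
  proof (rule topology_eq[THEN iffD2], intro allI iffI)
    fix U
    show "openin (mtopology_of (cfunspace X d)) U"
      if "openin (mtopology_of (cfunspace X (SOME d. mtopology_of d = M))) U"
      using s d c that by (rule uniform_convergence_topology_mono)
    show "openin (mtopology_of (cfunspace X (SOME d. mtopology_of d = M))) U"
      if "openin (mtopology_of (cfunspace X d)) U"
      using d s c that by (rule uniform_convergence_topology_mono)
  qed
qed


subsection \<open>Free spaces\<close>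

text \<open>
  A definition cannot quantify over all types, so the test compacta \<open>K\<close> range over all
  compact metrizable topologies whose carrier is a set of real sequences (not necessarily
  with the product topology).  By \<open>compactum_homeomorphic_sequence_space\<close> below, every
  compactum, on whatever type, is homeomorphic to one of these.  Since \<open>M\<close> need not be
  compact here, the condition on the fibers is stated directly instead of via \<open>Bing_map\<close>.
\<close>

definition free_space :: "'m topology \<Rightarrow> bool" where
  "free_space M \<longleftrightarrow>
     metrizable_space M \<and>
     (\<forall>K :: (nat \<Rightarrow> real) topology. compactum K \<longrightarrow>
        (\<exists>D \<subseteq> topspace (uniform_convergence_topology K M).
            uniform_convergence_topology K M closure_of D
              = topspace (uniform_convergence_topology K M) \<and>
            (\<forall>h\<in>D. \<forall>z\<in>topspace M. Bing_space (fiber K h z))))"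

lemma compactum_homeomorphic_sequence_space:
  assumes "compactum K"
  shows "\<exists>K' :: (nat \<Rightarrow> real) topology. compactum K' \<and> K homeomorphic_space K'"
proof -
  have cK: "compact_space K" and mK: "metrizable_space K" using assms by (auto simp: compactum_def)
  obtain d where d: "mtopology_of d = K" using mK metrizable_space_iff_mtopology_of by blast
  interpret Metric_space "mspace d" "mdist d" by simp
  have K: "K = mtopology" using d by (simp add: mtopology_of_def)
  have "mtotally_bounded (mspace d)"
    using cK K compactin_imp_mtotally_bounded unfolding compact_space_def by simp
  then have "\<exists>F. finite F \<and> F \<subseteq> mspace d \<and> mspace d \<subseteq> (\<Union>x\<in>F. mball x (1 / Suc n))" for n
    unfolding mtotally_bounded_def by (meson divide_pos_pos of_nat_0_less_iff zero_less_Suc zero_less_one)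
  then obtain F where F: "\<And>n. finite (F n)" "\<And>n. F n \<subseteq> mspace d"
      "\<And>n. mspace d \<subseteq> (\<Union>x\<in>F n. mball x (1 / Suc n))" by metis
  define D where "D = (\<Union>n. F n)"
  define p where "p = from_nat_into D"
  let ?P = "product_topology (\<lambda>_. euclideanreal) (UNIV :: nat set)"
  define \<phi> where "\<phi> x = (\<lambda>n. mdist d (p n) x)" for x
  have D: "countable D" "D \<subseteq> mspace d" using F by (auto simp: D_def intro: countable_finite)
  have inj: "inj_on \<phi> (mspace d)"
  proof
    fix x y assume xy: "x \<in> mspace d" "y \<in> mspace d" "\<phi> x = \<phi> y"
    show "x = y"
    proof (rule ccontr)
      assume "x \<noteq> y"
      then have pos: "mdist d x y > 0" using xy by simp
      then obtain n where n: "1 / Suc n < mdist d x y / 2"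
        by (metis half_gt_zero nat_approx_posE)
      obtain z where z: "z \<in> F n" "x \<in> mball z (1 / Suc n)" using F(3) xy(1) by blast
      then have "z \<in> D" by (auto simp: D_def)
      then obtain k where "z = p k" unfolding p_def by (metis D(1) from_nat_into_surj)
      then have "mdist d z x = mdist d z y" using xy(3) by (metis \<phi>_def)
      moreover have "mdist d x y \<le> mdist d x z + mdist d z y"
        using triangle xy z(2) by auto
      ultimately show False using z(2) n by (auto simp: mdist_commute)
    qed
  qed
  have cont: "continuous_map K ?P \<phi>"
  proof (cases "mspace d = {}")
    case True
    then have "topspace K = {}" unfolding K topspace_mtopology .
    then show ?thesis by (simp add: continuous_map_def)
  next
    case False
    have "D \<noteq> {}" using False F(3)[of 0] by (auto simp: D_def)
    then have "p n \<in> mspace d" for n using D(2) from_nat_into[of D n] by (auto simp: p_def)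
    then have "continuous_map K euclideanreal (mdist d (p n))" for n
      unfolding d[symmetric] by (rule continuous_on_mdist)
    then show ?thesis unfolding continuous_map_componentwise_UNIV \<phi>_def by blast
  qed
  have "Hausdorff_space ?P" by (simp add: Hausdorff_space_product_topology)
  then have "embedding_map K ?P \<phi>"
    using cK cont inj K
    by (intro injective_closed_imp_embedding_map T1_Spaces.continuous_imp_closed_map) auto
  then have h: "homeomorphic_map K (subtopology ?P (\<phi> ` topspace K)) \<phi>"
    by (simp add: embedding_map_def)
  then have "K homeomorphic_space subtopology ?P (\<phi> ` topspace K)"
    using homeomorphic_space by blast
  moreover from this have "compactum (subtopology ?P (\<phi> ` topspace K))"
    using cK mK unfolding compactum_def
    by (metis homeomorphic_compact_space homeomorphic_metrizable_space)
  ultimately show ?thesis by blast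
qed

end

theory Submission
  imports Defs
begin

text \<open>
  The key observation is that the parametric statement follows from a single application of
  freeness of \<open>M\<close>, to the compactum \<open>Q \<times> M\<close>, where \<open>Q\<close> is the Hilbert cube.  Let \<open>u : X \<rightarrow> Q\<close>
  witness \<open>W(f) \<le> \<aleph>\<^sub>0\<close> and let \<open>h : X \<rightarrow> M\<close> be the map to be approximated.  Freeness provides
  a map \<open>\<phi> : Q \<times> M \<rightarrow> M\<close> that is uniformly close to the projection \<open>(q, m) \<mapsto> m\<close> and whose fibers
  are Bing spaces (lemma \<open>free_space_approximates\<close>).  Then \<open>g x = \<phi> (u x, h x)\<close> is uniformly
  close to \<open>h\<close>.

  Since \<open>x \<mapsto> (f x, u x)\<close> is injective, \<open>u\<close> is injective on each fiber of \<open>f\<close>, and hence so is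
  \<open>x \<mapsto> (u x, h x)\<close>.  It therefore maps each fiber of \<open>g\<close> restricted to \<open>f\<^sup>-\<^sup>1(y)\<close>, which is compact,
  continuously and injectively into a fiber of \<open>\<phi>\<close>.  Compact spaces that inject continuously
  into a Bing space are Bing spaces, because subcontinua and their decompositions are carried
  along by such an injection (lemma \<open>Bing_space_continuous_injection\<close>).
\<close>

lemma subcontinuum_iff:
  assumes "metrizable_space X"
  shows "subcontinuum X C \<longleftrightarrow> compactin X C \<and> connectedin X C"
  using assms
  by (auto simp: subcontinuum_def continuum_def compactum_def compactin_subspace
      connectedin_def metrizable_space_subtopology)

lemma subcontinuum_subtopology:
  "A \<subseteq> C \<Longrightarrow> C \<subseteq> topspace X \<Longrightarrow> subcontinuum (subtopology X C) A \<longleftrightarrow> subcontinuum X A"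
  by (auto simp: subcontinuum_def subtopology_subtopology Int_absorb1 inf.absorb2)

lemma subcontinuum_continuous_image:
  assumes "metrizable_space Z" "metrizable_space B" "continuous_map Z B j" "subcontinuum Z C"
  shows "subcontinuum B (j ` C)"
  using assms by (auto simp: subcontinuum_iff image_compactin connectedin_continuous_map_image)

text \<open>
  This form of the definition mentions only subcontinua of the ambient space, which is what a
  map can transport.  A piece of a decomposition \<open>A \<union> B\<close> is improper exactly when it contains the
  other piece.
\<close>

lemma Bing_space_iff:
  "Bing_space X \<longleftrightarrow> compactum X \<and>
     (\<forall>A B. subcontinuum X A \<and> subcontinuum X B \<and> subcontinuum X (A \<union> B) \<longrightarrow>
        A \<subseteq> B \<or> B \<subseteq> A)"
proof -
  have "indecomposable_continuum (subtopology X C) \<longleftrightarrow>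
      (\<forall>A B. subcontinuum X A \<and> subcontinuum X B \<and> A \<union> B = C \<longrightarrow> A \<subseteq> B \<or> B \<subseteq> A)"
    if C: "subcontinuum X C" for C
  proof -
    have sub: "C \<subseteq> topspace X" and cont: "continuum (subtopology X C)"
      using C by (auto simp: subcontinuum_def)
    have top: "topspace (subtopology X C) = C" using sub by auto
    have piece: "subcontinuum (subtopology X C) A \<longleftrightarrow> subcontinuum X A \<and> A \<subseteq> C" for A
      using subcontinuum_subtopology[OF _ sub, of A] top by (auto simp: subcontinuum_def)
    show ?thesis
      unfolding indecomposable_continuum_def top piece using cont by blast
  qed
  then show ?thesis unfolding Bing_space_def by blast
qed

text \<open>
  Compactness of the domain makes the injection an embedding, which gives metrizability; the
  inclusion between images of subcontinua pulls back by injectivity.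
\<close>

lemma Bing_space_continuous_injection:
  assumes B: "Bing_space B" and Z: "compact_space Z"
    and j: "continuous_map Z B j" "inj_on j (topspace Z)"
  shows "Bing_space Z"
proof -
  have mB: "metrizable_space B" using B by (simp add: Bing_space_def compactum_def)
  have "embedding_map Z B j"
    using Z j metrizable_imp_Hausdorff_space[OF mB]
    by (intro continuous_imp_embedding_map)
  then have "Z homeomorphic_space subtopology B (j ` topspace Z)"
    by (rule embedding_map_imp_homeomorphic_space)
  then have mZ: "metrizable_space Z"
    using mB metrizable_space_subtopology homeomorphic_metrizable_space by blast
  have "P \<subseteq> Q \<or> Q \<subseteq> P"
    if "subcontinuum Z P" "subcontinuum Z Q" "subcontinuum Z (P \<union> Q)" for P Q
  proof -
    have sub: "P \<subseteq> topspace Z" "Q \<subseteq> topspace Z" using that by (auto simp: subcontinuum_def)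
    have "subcontinuum B (j ` P)" "subcontinuum B (j ` Q)" "subcontinuum B (j ` P \<union> j ` Q)"
      using that subcontinuum_continuous_image[OF mZ mB j(1)] by (auto simp flip: image_Un)
    then have "j ` P \<subseteq> j ` Q \<or> j ` Q \<subseteq> j ` P" using B unfolding Bing_space_iff by blast
    then show ?thesis using inj_on_image_subset_iff[OF j(2)] sub by blast
  qed
  then show ?thesis using Z mZ by (auto simp: Bing_space_iff compactum_def)
qed

text \<open>
  The fibers of the composite \<open>\<phi> \<circ> w\<close> are closed in the compact space \<open>F\<close>, and \<open>w\<close> injects them
  into fibers of \<open>\<phi>\<close>.
\<close>

lemma Bing_space_fiber_compose_injection:
  assumes F: "compact_space F" and M: "Hausdorff_space M" and z: "z \<in> topspace M"
    and w: "continuous_map F K w" "inj_on w (topspace F)"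
    and \<phi>: "continuous_map K M \<phi>" "Bing_space (fiber K \<phi> z)"
    and g: "\<And>x. x \<in> topspace F \<Longrightarrow> g x = \<phi> (w x)"
  shows "Bing_space (fiber F g z)"
proof (rule Bing_space_continuous_injection[OF \<phi>(2)])
  have "continuous_map F M g"
    using continuous_map_compose[OF w(1) \<phi>(1)] g by (auto intro: continuous_map_eq)
  then have "closedin F {x \<in> topspace F. g x \<in> {z}}"
    using closedin_Hausdorff_singleton[OF M z] by (rule closedin_continuous_map_preimage)
  then show "compact_space (fiber F g z)"
    unfolding fiber_def using F closedin_compact_space compact_space_subtopology by fastforce
  show "continuous_map (fiber F g z) (fiber K \<phi> z) w"
    unfolding fiber_def using w(1) g continuous_map_image_subset_topspace[OF w(1)]
    by (auto simp: continuous_map_in_subtopology continuous_map_from_subtopology)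
  show "inj_on w (topspace (fiber F g z))"
    using w(2) by (rule inj_on_subset) (auto simp: fiber_def)
qed

lemma dense_uniform_convergence_iff:
  assumes d: "mtopology_of d = M" and c: "compact_space X \<or> compact_space M"
    and D: "D \<subseteq> topspace (uniform_convergence_topology X M)"
  shows "uniform_convergence_topology X M closure_of D = topspace (uniform_convergence_topology X M)
     \<longleftrightarrow> (\<forall>h e. continuous_map X M h \<and> 0 < e \<longrightarrow>
            (\<exists>g\<in>D. \<forall>x\<in>topspace X. mdist d (h x) (g x) < e))"
proof -
  let ?F = "cfunspace X d"
  interpret F: Metric_space "mspace ?F" "mdist ?F" by (rule Metric_space_mspace_mdist)
  have top: "topspace (uniform_convergence_topology X M) = mspace ?F"
    by (simp only: uniform_convergence_topology_eq[OF d c] topspace_mtopology_of)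
  have DF: "D \<subseteq> mspace ?F" using D top by simp
  have closure: "uniform_convergence_topology X M closure_of D
      = {h \<in> mspace ?F. \<forall>r>0. \<exists>g\<in>D. mdist ?F h g < r}"
    unfolding uniform_convergence_topology_eq[OF d c] mtopology_of_def F.metric_closure_of
      F.in_mball using DF by blast
  have restr: "restrict h (topspace X) \<in> mspace ?F" if "continuous_map X M h" for h
    unfolding mspace_cfunspace_compact[OF d c]
    using that by (auto intro: continuous_map_eq)
  show ?thesis
    unfolding top closure
  proof (intro iffI allI impI)
    fix h and e :: real
    assume dense: "{h \<in> mspace ?F. \<forall>r>0. \<exists>g\<in>D. mdist ?F h g < r} = mspace ?F"
      and h: "continuous_map X M h \<and> 0 < e"
    let ?h = "restrict h (topspace X)"
    have hF: "?h \<in> mspace ?F" using restr h by blast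
    then obtain g where g: "g \<in> D" "mdist ?F ?h g < e" using dense h by blast
    have "mdist d (h x) (g x) < e" if "x \<in> topspace X" for x
      using mdist_cfunspace_imp_mdist_le[OF hF _ order_refl that, of g] g DF that by auto
    then show "\<exists>g\<in>D. \<forall>x\<in>topspace X. mdist d (h x) (g x) < e" using g by blast
  next
    assume approx: "\<forall>h e. continuous_map X M h \<and> 0 < e \<longrightarrow>
            (\<exists>g\<in>D. \<forall>x\<in>topspace X. mdist d (h x) (g x) < e)"
    have "\<exists>g\<in>D. mdist ?F h g < r" if h: "h \<in> mspace ?F" and r: "r > 0" for h r
    proof -
      have "continuous_map X M h" using h mspace_cfunspace_compact[OF d c] by blast
      then obtain g where g: "g \<in> D" "\<forall>x\<in>topspace X. mdist d (h x) (g x) < r / 2"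
        using approx r half_gt_zero by blast
      \<comment> \<open>Strict pointwise bounds give only a non-strict bound on the supremum, hence the \<open>r / 2\<close>.\<close>
      have "mdist ?F h g \<le> r / 2"
        using g r by (intro mdist_cfunspace_le) auto
      then show ?thesis using g r by force
    qed
    then show "{h \<in> mspace ?F. \<forall>r>0. \<exists>g\<in>D. mdist ?F h g < r} = mspace ?F" by blast
  qed
qed

text \<open>
  The definition of a free space tests only compacta of real sequences; precomposing with a
  homeomorphism onto such a compactum transfers approximations by Bing maps to every
  compactum \<open>K\<close>, without changing the fibers topologically.
\<close>

lemma free_space_approximates:
  assumes M: "free_space M" "mtopology_of d = M" and K: "compactum K"
    and p: "continuous_map K M p" and e: "e > 0"
  obtains \<phi> where "continuous_map K M \<phi>" "\<And>k. k \<in> topspace K \<Longrightarrow> mdist d (p k) (\<phi> k) < e"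
    "\<And>z. z \<in> topspace M \<Longrightarrow> Bing_space (fiber K \<phi> z)"
proof -
  obtain K' :: "(nat \<Rightarrow> real) topology" where K': "compactum K'" "K homeomorphic_space K'"
    using compactum_homeomorphic_sequence_space[OF K] by blast
  then obtain s t where st: "homeomorphic_maps K K' s t" unfolding homeomorphic_space_def by blast
  have s: "continuous_map K K' s" and t: "continuous_map K' K t"
    and ts: "\<And>k. k \<in> topspace K \<Longrightarrow> t (s k) = k"
    using st by (auto simp: homeomorphic_maps_def)
  have mM: "metrizable_space M" and cK: "compact_space K" and cK': "compact_space K'"
    using M(1) K K' by (auto simp: free_space_def compactum_def)
  obtain D where D: "D \<subseteq> topspace (uniform_convergence_topology K' M)"
    and dense: "uniform_convergence_topology K' M closure_of D
       = topspace (uniform_convergence_topology K' M)"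
    and Bing: "\<And>h z. h \<in> D \<Longrightarrow> z \<in> topspace M \<Longrightarrow> Bing_space (fiber K' h z)"
    using M(1) K'(1) unfolding free_space_def by meson
  have "continuous_map K' M (p \<circ> t)" using t p by (rule continuous_map_compose)
  then obtain \<psi> where \<psi>: "\<psi> \<in> D" "\<forall>x\<in>topspace K'. mdist d ((p \<circ> t) x) (\<psi> x) < e"
    using dense e dense_uniform_convergence_iff[OF M(2) _ D] cK' by blast
  have \<psi>c: "continuous_map K' M \<psi>"
    using \<psi>(1) D topspace_uniform_convergence_topology[OF mM, of K'] cK' by blast
  have c: "continuous_map K M (\<psi> \<circ> s)" using s \<psi>c by (rule continuous_map_compose)
  have s_in: "s k \<in> topspace K'" if "k \<in> topspace K" for k
    using s that continuous_map_image_subset_topspace by fastforce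
  show thesis
  proof (rule that[OF c])
    show "mdist d (p k) ((\<psi> \<circ> s) k) < e" if "k \<in> topspace K" for k
      using \<psi>(2) s_in[OF that] ts[OF that] by fastforce
    show "Bing_space (fiber K (\<psi> \<circ> s) z)" if z: "z \<in> topspace M" for z
    proof (rule Bing_space_fiber_compose_injection[OF cK _ z s _ \<psi>c Bing[OF \<psi>(1) z]])
      show "Hausdorff_space M" using mM by (rule metrizable_imp_Hausdorff_space)
      show "inj_on s (topspace K)" by (rule inj_on_inverseI) (rule ts)
    qed simp
  qed
qed

lemma compactum_hilbert_cube: "compactum hilbert_cube"
  unfolding hilbert_cube_def compactum_def
  by (auto simp: compact_space_product_topology metrizable_space_product_topology
      compact_space_subtopology metrizable_space_subtopology metrizable_space_euclidean)

lemma compactum_prod_topology: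
  "compactum K \<Longrightarrow> compactum L \<Longrightarrow> compactum (prod_topology K L)"
  by (auto simp: compactum_def compact_space_prod_topology metrizable_space_prod_topology)

theorem theorem1p2:
  fixes X :: "'a topology" and Y :: "'b topology" and M :: "'m topology" and f :: "'a \<Rightarrow> 'b"
  assumes "paracompact_space X" and "Hausdorff_space X"
    and "paracompact_space Y" and "Hausdorff_space Y"
    and "continuous_map X Y f"
    and "\<And>y. y \<in> topspace Y \<Longrightarrow> compact_space (fiber X f y)"
    and "W_le_aleph0 X Y f"
    and "compact_space M" and "metrizable_space M" and "free_space M"
  shows "\<exists>D \<subseteq> topspace (uniform_convergence_topology X M).
           uniform_convergence_topology X M closure_of D
             = topspace (uniform_convergence_topology X M) \<and>
           (\<forall>g\<in>D. \<forall>y\<in>topspace Y. Bing_map (fiber X f y) M g)"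
proof -
  obtain d where d: "mtopology_of d = M"
    using assms(9) metrizable_space_iff_mtopology_of by blast
  obtain u where u: "continuous_map X hilbert_cube u"
    and emb: "embedding_map X (prod_topology Y hilbert_cube) (\<lambda>x. (f x, u x))"
    using assms(7) unfolding W_le_aleph0_def by blast
  have inj: "inj_on (\<lambda>x. (f x, u x)) (topspace X)"
    using emb by (simp add: embedding_map_def homeomorphic_eq_everything_map)
  let ?K = "prod_topology hilbert_cube M"
  have K: "compactum ?K"
    using compactum_hilbert_cube assms(8,9) by (intro compactum_prod_topology) (simp_all add: compactum_def)
  define D where "D = {g \<in> topspace (uniform_convergence_topology X M).
      \<forall>y\<in>topspace Y. Bing_map (fiber X f y) M g}"
  have "\<exists>g\<in>D. \<forall>x\<in>topspace X. mdist d (h x) (g x) < e"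
    if h: "continuous_map X M h" and e: "0 < e" for h and e :: real
  proof -
    obtain \<phi> where \<phi>: "continuous_map ?K M \<phi>"
      "\<And>k. k \<in> topspace ?K \<Longrightarrow> mdist d (snd k) (\<phi> k) < e"
      "\<And>z. z \<in> topspace M \<Longrightarrow> Bing_space (fiber ?K \<phi> z)"
      using free_space_approximates[OF assms(10) d K continuous_map_snd e] by blast
    define w where "w x = (u x, h x)" for x
    have w: "continuous_map X ?K w"
      unfolding w_def using u h by (simp add: continuous_map_paired)
    define g where "g = restrict (\<phi> \<circ> w) (topspace X)"
    have gc: "continuous_map X M g"
      using continuous_map_compose[OF w \<phi>(1)] unfolding g_def by (auto intro: continuous_map_eq)
    have "Bing_map (fiber X f y) M g" if y: "y \<in> topspace Y" for y
    proof -
      have wy: "continuous_map (fiber X f y) ?K w"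
        unfolding fiber_def using w by (rule continuous_map_from_subtopology)
      \<comment> \<open>\<open>f\<close> is constant on this fiber, so it is \<open>u\<close> that separates its points.\<close>
      have injy: "inj_on w (topspace (fiber X f y))"
        using inj by (auto simp: inj_on_def fiber_def w_def)
      have "Bing_space (fiber (fiber X f y) g z)" if z: "z \<in> topspace M" for z
        using assms(6)[OF y] metrizable_imp_Hausdorff_space[OF assms(9)] z wy injy \<phi>(1) \<phi>(3)[OF z]
        by (rule Bing_space_fiber_compose_injection) (simp add: g_def fiber_def)
      moreover have "continuous_map (fiber X f y) M g"
        unfolding fiber_def using gc by (rule continuous_map_from_subtopology)
      ultimately show ?thesis using assms(6)[OF y] assms(8) by (simp add: Bing_map_def)
    qed
    then have "g \<in> D"
      using gc assms(8) topspace_uniform_convergence_topology[OF assms(9), of X]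
      by (simp add: D_def g_def)
    moreover have "mdist d (h x) (g x) < e" if x: "x \<in> topspace X" for x
    proof -
      have "w x \<in> topspace ?K" using continuous_map_image_subset_topspace[OF w] x by blast
      from \<phi>(2)[OF this] show ?thesis using x by (simp add: w_def g_def)
    qed
    ultimately show ?thesis by blast
  qed
  moreover have "D \<subseteq> topspace (uniform_convergence_topology X M)" by (auto simp: D_def)
  ultimately have "uniform_convergence_topology X M closure_of D
      = topspace (uniform_convergence_topology X M)"
    using dense_uniform_convergence_iff[OF d] assms(8) by blast
  then show ?thesis by (intro exI[of _ D]) (auto simp: D_def)
qed

end
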